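(* Let $a\geq 0$ and $k\geq 2$ be integers and let $b=ak+k-1$. Let $T$ be a tree with $k$ interior vertices and $b$ leaves. Then $$\lambda_1(T)\ \leq\ \frac{k+2a+1-\sqrt{(k-1)^2+4}}{2}.$$ Equality holds if and only if $T$ is (isomorphic to) the star-like path tree $SLP(a,a+1;0;k-1,0)$.
   Context: For a finite tree $T=(V,E)$ with at least three vertices, the boundary $B$ is the set of leaves (degree-one vertices) and the interior is $\Omega=V\setminus B$; interior vertices are the non-leaf vertices. The first Dirichlet eigenvalue $\lambda_1(T)$ is the smallest $\lambda$ for which there is a nonzero $f:V\to\mathbb{R}$ with $f=0$ on $B$ and $\sum_{y\sim x}(f(x)-f(y))=\lambda f(x)$ for all $x\in\Omega$. Star-like path tree: for integers $q\geq1$ and $p,c,d,e\geq 0$, $SLP(p,q;c;d,e)$ is the tree obtained as follows. Take a path $u_0\sim u_1\sim\cdots\sim u_c$ of length $c$ (a single vertex $u_0=u_c$ if $c=0$). Attach $d$ new vertices $u_{0,1},\dots,u_{0,d}$ to $u_0$ and $e$ new vertices $u_{c,1},\dots,u_{c,e}$ to $u_c$. Then attach $p$ leaves to each vertex of the set $\{u_0,u_c\}$, and attach $q$ leaves to each of the vertices $u_{0,i}$ ($1\le i\le d$), $u_{c,j}$ ($1\le j\le e$), and $u_1,\dots,u_{c-1}$. In particular, $SLP(a,a+1;0;k-1,0)$ consists of a vertex $u_0$ with $a$ leaves attached, adjacent to $k-1$ further vertices each having $a+1$ leaves attached. *)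

theory Defs
  imports Complex_Main "Graph_Theory.Graph_Theory"
begin

text \<open>
  A finite simple graph is represented by a symmetric, loop-free, finite digraph without parallel
  arcs (locale \<^locale>\<open>pair_graph\<close>), each edge giving the two arcs \<open>(x, y)\<close> and \<open>(y, x)\<close>.

  The library predicates \<open>forest\<close> and \<open>tree\<close> are not usable on this representation: they forbid
  every directed cycle, and in a symmetric digraph each edge gives the cycle \<open>x, y, x\<close>.
  A cycle of the undirected graph is a directed cycle of length at least 3.
\<close>

definition graph_tree :: "'a pair_pre_digraph \<Rightarrow> bool" where
  "graph_tree T \<longleftrightarrow>
     pair_graph T \<and> Digraph_Component.connected (with_proj T) \<and>
     \<not> (\<exists>p. pre_digraph.cycle (with_proj T) p \<and> length p \<ge> 3)"

definition leaf_verts :: "'a pair_pre_digraph \<Rightarrow> 'a set" where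
  "leaf_verts T = {v \<in> pverts T. out_degree (with_proj T) v = 1}"

definition inner_verts :: "'a pair_pre_digraph \<Rightarrow> 'a set" where
  "inner_verts T = pverts T - leaf_verts T"

text \<open>Values of \<open>f\<close> outside \<open>pverts T\<close> are irrelevant, so \<open>f\<close> has to be nonzero on \<open>pverts T\<close>.\<close>

definition dirichlet_eigenvalue :: "'a pair_pre_digraph \<Rightarrow> real \<Rightarrow> bool" where
  "dirichlet_eigenvalue T l \<longleftrightarrow>
     (\<exists>f :: 'a \<Rightarrow> real.
        (\<exists>x \<in> pverts T. f x \<noteq> 0) \<and>
        (\<forall>x \<in> leaf_verts T. f x = 0) \<and>
        (\<forall>x \<in> inner_verts T. (\<Sum>y | (x, y) \<in> parcs T. f x - f y) = l * f x))"

definition dirichlet_lambda1 :: "'a pair_pre_digraph \<Rightarrow> real" where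
  "dirichlet_lambda1 T = (LEAST l. dirichlet_eigenvalue T l)"

text \<open>
  Star-like path trees. \<open>Spine i\<close> is \<open>u\<^sub>i\<close>, \<open>Left_Nbr i\<close> is \<open>u\<^bsub>0,i\<^esub>\<close>, \<open>Right_Nbr j\<close> is \<open>u\<^bsub>c,j\<^esub>\<close>,
  and \<open>Pendant v m\<close> is the \<open>m\<close>-th leaf attached to \<open>v\<close>. For \<open>c = 0\<close> the vertices \<open>u\<^sub>0\<close> and \<open>u\<^sub>c\<close>
  coincide, and this vertex receives \<open>p\<close> leaves only once.
\<close>

datatype slp_vertex =
  Spine nat | Left_Nbr nat | Right_Nbr nat | Pendant slp_vertex nat

definition slp_core :: "nat \<Rightarrow> nat \<Rightarrow> nat \<Rightarrow> slp_vertex set" where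
  "slp_core c d e = Spine ` {0..c} \<union> Left_Nbr ` {1..d} \<union> Right_Nbr ` {1..e}"

definition slp_pendants :: "nat \<Rightarrow> nat \<Rightarrow> nat \<Rightarrow> slp_vertex \<Rightarrow> nat" where
  "slp_pendants p q c v = (if v \<in> {Spine 0, Spine c} then p else q)"

definition slp_edges :: "nat \<Rightarrow> nat \<Rightarrow> nat \<Rightarrow> nat \<Rightarrow> nat \<Rightarrow> slp_vertex rel" where
  "slp_edges p q c d e =
     {(Spine i, Spine (Suc i)) | i. i < c} \<union>
     {(Spine 0, Left_Nbr i) | i. i \<in> {1..d}} \<union>
     {(Spine c, Right_Nbr j) | j. j \<in> {1..e}} \<union>
     {(v, Pendant v m) | v m. v \<in> slp_core c d e \<and> m \<in> {1..slp_pendants p q c v}}"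

definition SLP :: "nat \<Rightarrow> nat \<Rightarrow> nat \<Rightarrow> nat \<Rightarrow> nat \<Rightarrow> slp_vertex pair_pre_digraph" where
  "SLP p q c d e =
     \<lparr> pverts = slp_core c d e \<union>
         {Pendant v m | v m. v \<in> slp_core c d e \<and> m \<in> {1..slp_pendants p q c v}},
       parcs = slp_edges p q c d e \<union> (slp_edges p q c d e)\<inverse> \<rparr>"

end

theory Submission
  imports Defs "HOL-Analysis.Function_Topology"
begin

text \<open>
  By the variational principle, \<open>\<lambda>\<^sub>1\<close> is at most the Rayleigh quotient of any test function, with
  equality only for eigenfunctions. Since the number of leaves is less than \<open>k(a + 1)\<close>, some
  interior vertex \<open>c\<close> has at most \<open>a\<close> leaves. The test function is the eigenfunction of the extremal
  tree centred at \<open>c\<close>: it is \<open>1\<close> at \<open>c\<close> and a constant \<open>t < 1\<close> at all other interior vertices. Its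
  Rayleigh quotient is at most the bound because \<open>c\<close> has at most \<open>k - 1\<close> interior neighbours and at
  most \<open>a\<close> leaves. If equality holds, both numbers are attained, so the interior is a star with
  centre \<open>c\<close> as there are no triangles, and the eigenvalue equation at the other interior vertices
  forces each of them to have \<open>a + 1\<close> leaves.
\<close>

section \<open>Minima of symmetric quadratic forms\<close>

text \<open>Functions on \<open>S\<close> are extended by 0 to the whole type, since free
  coordinates outside \<open>S\<close> would destroy compactness. The sphere is then a closed subset
  of a product of compact sets, and Tychonoff applies.\<close>

lemma compact_unit_sphere_fun:
  assumes "finite S"
  shows "compact {f :: 'a \<Rightarrow> real. (\<forall>x. x \<notin> S \<longrightarrow> f x = 0) \<and> (\<Sum>x\<in>S. (f x)\<^sup>2) = 1}"
    (is "compact ?K")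
proof -
  define B :: "('a \<Rightarrow> real) set" where "B = PiE UNIV (\<lambda>x. if x \<in> S then {-1..1} else {0})"
  have "compact B"
    unfolding B_def compactin_euclidean_iff [symmetric] euclidean_product_topology [symmetric]
    by (subst compactin_PiE) auto
  moreover have "closed {f :: 'a \<Rightarrow> real. (\<Sum>x\<in>S. (f x)\<^sup>2) = 1}"
    by (intro closed_Collect_eq continuous_intros continuous_on_product_coordinates)
  moreover have "?K = B \<inter> {f. (\<Sum>x\<in>S. (f x)\<^sup>2) = 1}"
  proof -
    have "\<bar>f x\<bar> \<le> 1" if "(\<Sum>x\<in>S. (f x)\<^sup>2) = 1" "x \<in> S" for f :: "'a \<Rightarrow> real" and x
    proof -
      have "(f x)\<^sup>2 \<le> (\<Sum>x\<in>S. (f x)\<^sup>2)"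
        using assms that by (intro member_le_sum) auto
      then show ?thesis using that by (simp add: abs_square_le_1)
    qed
    then show ?thesis
      unfolding B_def by (fastforce simp: PiE_iff abs_le_iff split: if_splits)
  qed
  ultimately show ?thesis by (simp add: compact_Int_closed)
qed

text \<open>The continuous form attains its minimum \<open>m\<close> on the compact unit sphere.
  Homogeneity of degree 2 carries the lower bound over to all functions.\<close>

lemma quadratic_form_minimizer:
  fixes A :: "'a \<Rightarrow> 'a \<Rightarrow> real"
  assumes "finite S" "S \<noteq> {}"
  obtains f m where "\<exists>x\<in>S. f x \<noteq> 0"
    "(\<Sum>x\<in>S. f x * (\<Sum>y\<in>S. A x y * f y)) = m * (\<Sum>x\<in>S. (f x)\<^sup>2)"
    "\<And>g. m * (\<Sum>x\<in>S. (g x)\<^sup>2) \<le> (\<Sum>x\<in>S. g x * (\<Sum>y\<in>S. A x y * g y))"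
proof -
  define K where "K = {f :: 'a \<Rightarrow> real. (\<forall>x. x \<notin> S \<longrightarrow> f x = 0) \<and> (\<Sum>x\<in>S. (f x)\<^sup>2) = 1}"
  define Q where "Q f = (\<Sum>x\<in>S. f x * (\<Sum>y\<in>S. A x y * f y))" for f
  have "compact K" unfolding K_def using assms(1) by (rule compact_unit_sphere_fun)
  moreover have "K \<noteq> {}"
  proof -
    obtain s where "s \<in> S" using assms by auto
    then have "(\<lambda>x. if x = s then 1 else 0) \<in> K"
      unfolding K_def using assms by (auto simp: if_distrib [of "\<lambda>z. z\<^sup>2"] cong: if_cong)
    then show ?thesis by auto
  qed
  moreover have "continuous_on K Q"
    unfolding Q_def
    by (intro continuous_intros continuous_on_subset [OF continuous_on_product_coordinates]) auto
  ultimately obtain f where f: "f \<in> K" and min: "\<And>g. g \<in> K \<Longrightarrow> Q f \<le> Q g"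
    using continuous_attains_inf by meson
  have scale: "Q (\<lambda>x. r * g x) = r\<^sup>2 * Q g" for r g
    unfolding Q_def by (simp add: sum_distrib_left power2_eq_square mult_ac)
  have cong: "Q g = Q h" if "\<And>x. x \<in> S \<Longrightarrow> g x = h x" for g h
    unfolding Q_def using that by (auto intro!: sum.cong)
  have "Q f * (\<Sum>x\<in>S. (g x)\<^sup>2) \<le> Q g" for g
  proof (cases "\<forall>x\<in>S. g x = 0")
    case True
    then show ?thesis by (simp add: Q_def)
  next
    case False
    define n where "n = (\<Sum>x\<in>S. (g x)\<^sup>2)"
    \<comment> \<open>\<open>g\<close> is normalised and cut off outside \<open>S\<close>, which the
      form does not see, so that it lies in \<open>K\<close>.\<close>
    define h where "h x = (if x \<in> S then (1 / sqrt n) * g x else 0)" for x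
    have n: "n > 0"
      unfolding n_def using False assms
      by (metis (no_types, lifting) sum_nonneg_eq_0_iff sum_nonneg less_eq_real_def
          zero_le_power2 zero_eq_power2)
    have "(\<Sum>x\<in>S. (h x)\<^sup>2) = (1 / sqrt n)\<^sup>2 * n"
      unfolding n_def sum_distrib_left
      by (intro sum.cong) (simp_all add: h_def n_def power_mult_distrib power_divide)
    then have "h \<in> K" using n unfolding K_def h_def by (simp add: power_divide)
    then have "Q f \<le> Q h" by (rule min)
    also have "\<dots> = Q (\<lambda>x. (1 / sqrt n) * g x)"
      by (rule cong) (simp add: h_def)
    also have "\<dots> = Q g / n"
      unfolding scale using n by (simp add: power_divide)
    finally show ?thesis using n by (simp add: n_def pos_le_divide_eq)
  qed
  moreover have 1: "(\<Sum>x\<in>S. (f x)\<^sup>2) = 1"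
    using f unfolding K_def by auto
  moreover have "\<exists>x\<in>S. f x \<noteq> 0"
  proof (rule ccontr)
    assume "\<not> ?thesis"
    then have "(\<Sum>x\<in>S. (f x)\<^sup>2) = 0" by (intro sum.neutral) auto
    with 1 show False by simp
  qed
  ultimately show ?thesis
    using that [of f "Q f"] unfolding Q_def by simp
qed

text \<open>First-order condition: the form minus \<open>m\<close> times the squared norm is
  nonnegative and vanishes at \<open>f\<close>, so its derivative at \<open>f\<close> in each
  coordinate direction is 0. By symmetry of \<open>A\<close> this derivative is twice the residual
  \<open>D\<close>.\<close>

lemma quadratic_form_minimizer_eigenvector:
  fixes A :: "'a \<Rightarrow> 'a \<Rightarrow> real"
  assumes fin: "finite S"
    and sym: "\<And>x y. x \<in> S \<Longrightarrow> y \<in> S \<Longrightarrow> A x y = A y x"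
    and lower: "\<And>g. m * (\<Sum>x\<in>S. (g x)\<^sup>2) \<le> (\<Sum>x\<in>S. g x * (\<Sum>y\<in>S. A x y * g y))"
    and eq: "(\<Sum>x\<in>S. f x * (\<Sum>y\<in>S. A x y * f y)) = m * (\<Sum>x\<in>S. (f x)\<^sup>2)"
    and z: "z \<in> S"
  shows "(\<Sum>y\<in>S. A z y * f y) = m * f z"
proof -
  define D where "D = (\<Sum>y\<in>S. A z y * f y) - m * f z"
  define \<delta> where "\<delta> x = (if x = z then 1 else 0 :: real)" for x
  have \<delta>: "(\<Sum>x\<in>S. \<delta> x * h x) = h z" "(\<Sum>x\<in>S. h x * \<delta> x) = h z" for h
    using fin z by (simp_all add: \<delta>_def if_distrib if_distribR cong: if_cong)
  have quad: "0 \<le> 2 * s * D + s\<^sup>2 * (A z z - m)" for s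
  proof -
    define g where "g x = f x + s * \<delta> x" for x
    have "(\<Sum>y\<in>S. A x y * g y) = (\<Sum>y\<in>S. A x y * f y) + s * A x z" for x
      by (simp add: g_def distrib_left sum.distrib mult.left_commute [of _ s]
          sum_distrib_left [symmetric] \<delta>)
    then have "(\<Sum>x\<in>S. g x * (\<Sum>y\<in>S. A x y * g y)) =
        (\<Sum>x\<in>S. f x * (\<Sum>y\<in>S. A x y * f y)) + s * (\<Sum>x\<in>S. f x * A x z)
        + s * (\<Sum>x\<in>S. \<delta> x * (\<Sum>y\<in>S. A x y * f y)) + s\<^sup>2 * (\<Sum>x\<in>S. \<delta> x * A x z)"
      by (simp add: g_def algebra_simps sum.distrib sum_distrib_left power2_eq_square)
    moreover have "(\<Sum>x\<in>S. f x * A x z) = (\<Sum>y\<in>S. A z y * f y)"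
      by (intro sum.cong) (simp_all add: sym z mult.commute)
    moreover have "(\<Sum>x\<in>S. (g x)\<^sup>2) =
        (\<Sum>x\<in>S. (f x)\<^sup>2) + 2 * s * (\<Sum>x\<in>S. \<delta> x * f x) + s\<^sup>2 * (\<Sum>x\<in>S. \<delta> x * \<delta> x)"
      by (simp add: g_def power2_eq_square algebra_simps sum.distrib sum_distrib_left)
    ultimately show ?thesis
      using lower [of g] eq unfolding \<delta> D_def by (simp add: \<delta>_def algebra_simps)
  qed
  \<comment> \<open>A quadratic polynomial in \<open>s\<close> without constant term is nonnegative only if its linear
    coefficient vanishes.\<close>
  have "D = 0"
  proof (rule ccontr)
    assume "D \<noteq> 0"
    \<comment> \<open>The summand 1 keeps \<open>C\<close> positive. The value
      \<open>- D / C\<close> is the minimum point of \<open>2 * s * D + s\<^sup>2 * C\<close> in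
      \<open>s\<close>.\<close>
    define C where "C = \<bar>A z z - m\<bar> + 1"
    have C: "C > 0" "A z z - m \<le> C" by (auto simp: C_def)
    have "2 * (- D / C) * D + (- D / C)\<^sup>2 * (A z z - m) \<le> 2 * (- D / C) * D + (- D / C)\<^sup>2 * C"
      using C by (intro add_left_mono mult_left_mono) auto
    also have "\<dots> = - (D\<^sup>2 / C)"
      using C by (simp add: field_simps power2_eq_square)
    also have "\<dots> < 0" using C \<open>D \<noteq> 0\<close> by simp
    finally show False using quad [of "- D / C"] by simp
  qed
  then show ?thesis by (simp add: D_def)
qed

section \<open>The Dirichlet form of a graph\<close>

definition pendants :: "'a pair_pre_digraph \<Rightarrow> 'a \<Rightarrow> 'a set" where
  "pendants T x = {y \<in> leaf_verts T. (x, y) \<in> parcs T}"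

definition inner_nbrs :: "'a pair_pre_digraph \<Rightarrow> 'a \<Rightarrow> 'a set" where
  "inner_nbrs T x = {y \<in> inner_verts T. (x, y) \<in> parcs T}"

text \<open>On a finite simple graph, for \<open>f\<close> vanishing on the leaves, this is the sum
  of the squared differences of \<open>f\<close> over all edges, the numerator of the Rayleigh
  quotient.\<close>

definition dirichlet_form :: "'a pair_pre_digraph \<Rightarrow> ('a \<Rightarrow> real) \<Rightarrow> real" where
  "dirichlet_form T f = (\<Sum>x\<in>inner_verts T. f x * (\<Sum>y | (x, y) \<in> parcs T. f x - f y))"

lemma leaf_verts_iff:
  "v \<in> leaf_verts T \<longleftrightarrow> v \<in> pverts T \<and> (\<exists>w. {y. (v, y) \<in> parcs T} = {w})"
proof -
  have "out_arcs (with_proj T) v = Pair v ` {y. (v, y) \<in> parcs T}"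
    by (auto simp: out_arcs_def)
  then have "out_degree (with_proj T) v = card {y. (v, y) \<in> parcs T}"
    unfolding out_degree_def by (simp add: card_image inj_on_def)
  then show ?thesis
    by (auto simp: leaf_verts_def card_1_singleton_iff)
qed

lemma leaf_unique_nbr:
  assumes "v \<in> leaf_verts T" "(v, x) \<in> parcs T" "(v, y) \<in> parcs T"
  shows "x = y"
proof -
  obtain w where "{y. (v, y) \<in> parcs T} = {w}"
    using assms(1) unfolding leaf_verts_iff by blast
  then show ?thesis
    using assms(2,3) by (metis mem_Collect_eq singletonD)
qed

lemma inner_leaf_partition:
  "inner_verts T \<union> leaf_verts T = pverts T" "inner_verts T \<inter> leaf_verts T = {}"
  by (auto simp: inner_verts_def leaf_verts_def)

locale simple_graph =
  fixes T :: "'a pair_pre_digraph"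
  assumes graph: "pair_graph T"
begin

interpretation G: pair_graph T by (fact graph)

lemma finite_inner [simp]: "finite (inner_verts T)"
  and finite_leaf [simp]: "finite (leaf_verts T)"
  and finite_pendants [simp]: "finite (pendants T x)"
  and finite_inner_nbrs [simp]: "finite (inner_nbrs T x)"
  using G.pair_finite_verts
  by (simp_all add: pendants_def inner_nbrs_def inner_verts_def leaf_verts_def)

lemma nbrs_eq: "{y. (x, y) \<in> parcs T} = inner_nbrs T x \<union> pendants T x"
  using inner_leaf_partition [of T] by (auto simp: inner_nbrs_def pendants_def dest: G.in_arcsD2)

lemma sum_nbrs:
  fixes g :: "'a \<Rightarrow> real"
  shows "(\<Sum>y | (x, y) \<in> parcs T. g y) = (\<Sum>y\<in>inner_nbrs T x. g y) + (\<Sum>y\<in>pendants T x. g y)"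
  unfolding nbrs_eq using inner_leaf_partition [of T]
  by (intro sum.union_disjoint) (auto simp: inner_nbrs_def pendants_def)

lemma pendants_disjoint: "x \<noteq> y \<Longrightarrow> pendants T x \<inter> pendants T y = {}"
  using leaf_unique_nbr [of _ T] by (auto simp: pendants_def dest: G.arcs_symmetric)

lemma card_UN_pendants:
  "finite S \<Longrightarrow> card (\<Union>x\<in>S. pendants T x) = (\<Sum>x\<in>S. card (pendants T x))"
  using pendants_disjoint by (intro card_UN_disjoint) auto

text \<open>Distinct vertices have disjoint sets of pendants, as a leaf has one neighbour. A leaf
  adjacent to another leaf is counted at no interior vertex, hence only an inequality.\<close>

lemma sum_card_pendants_le: "(\<Sum>x\<in>inner_verts T. card (pendants T x)) \<le> card (leaf_verts T)"
  by (subst card_UN_pendants [symmetric]) (auto intro!: card_mono simp: pendants_def)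

text \<open>The graph Laplacian, to be restricted to interior vertices. The diagonal keeps the full
  degree, leaf neighbours included, which encodes the boundary values 0.\<close>

definition dirichlet_matrix :: "'a \<Rightarrow> 'a \<Rightarrow> real" where
  "dirichlet_matrix x y =
     (if x = y then real (card {y. (x, y) \<in> parcs T}) else 0) - (if (x, y) \<in> parcs T then 1 else 0)"

lemma dirichlet_matrix_sym: "dirichlet_matrix x y = dirichlet_matrix y x"
  by (auto simp: dirichlet_matrix_def dest: G.arcs_symmetric)

lemma dirichlet_matrix_apply:
  assumes "x \<in> inner_verts T" and f: "\<And>y. y \<in> leaf_verts T \<Longrightarrow> f y = 0"
  shows "(\<Sum>y | (x, y) \<in> parcs T. f x - f y) = (\<Sum>y\<in>inner_verts T. dirichlet_matrix x y * f y)"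
proof -
  have "(\<Sum>y\<in>pendants T x. f y) = 0"
    using f by (intro sum.neutral) (auto simp: pendants_def)
  moreover have "(\<Sum>y\<in>inner_nbrs T x. f y) =
      (\<Sum>y\<in>inner_verts T. if (x, y) \<in> parcs T then f y else 0)"
    unfolding inner_nbrs_def by (simp add: sum.If_cases Int_def)
  ultimately show ?thesis
    using assms(1) unfolding sum_subtractf sum_nbrs [of f]
    by (simp add: dirichlet_matrix_def left_diff_distrib sum_subtractf
        if_distribR if_distrib [of "\<lambda>z. z * _"] cong: if_cong)
qed

text \<open>\<open>LEAST\<close> over the reals is informative only once a least eigenvalue is known
  to exist. The minimum of the quadratic form is one: it is an eigenvalue, and every eigenvalue is
  the Rayleigh quotient of its eigenfunction.\<close>

lemma dirichlet_lambda1_variational: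
  assumes "inner_verts T \<noteq> {}"
  shows "dirichlet_eigenvalue T (dirichlet_lambda1 T)"
    and "\<And>f. (\<And>y. y \<in> leaf_verts T \<Longrightarrow> f y = 0) \<Longrightarrow>
      dirichlet_lambda1 T * (\<Sum>x\<in>inner_verts T. (f x)\<^sup>2) \<le> dirichlet_form T f"
    and "\<And>f x. (\<And>y. y \<in> leaf_verts T \<Longrightarrow> f y = 0) \<Longrightarrow>
      dirichlet_form T f = dirichlet_lambda1 T * (\<Sum>x\<in>inner_verts T. (f x)\<^sup>2) \<Longrightarrow>
      x \<in> inner_verts T \<Longrightarrow> (\<Sum>y | (x, y) \<in> parcs T. f x - f y) = dirichlet_lambda1 T * f x"
proof -
  let ?S = "inner_verts T"
  let ?A = dirichlet_matrix
  obtain m f where nz: "\<exists>x\<in>?S. f x \<noteq> 0"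
    and att: "(\<Sum>x\<in>?S. f x * (\<Sum>y\<in>?S. ?A x y * f y)) = m * (\<Sum>x\<in>?S. (f x)\<^sup>2)"
    and low: "\<And>g. m * (\<Sum>x\<in>?S. (g x)\<^sup>2) \<le> (\<Sum>x\<in>?S. g x * (\<Sum>y\<in>?S. ?A x y * g y))"
    by (rule quadratic_form_minimizer [OF finite_inner assms, of ?A]) (rule that)
  have form: "dirichlet_form T g = (\<Sum>x\<in>?S. g x * (\<Sum>y\<in>?S. ?A x y * g y))"
    if "\<And>y. y \<in> leaf_verts T \<Longrightarrow> g y = 0" for g
    unfolding dirichlet_form_def using that by (intro sum.cong) (simp_all add: dirichlet_matrix_apply)
  \<comment> \<open>The minimiser \<open>f\<close> is arbitrary outside the interior; cutting it off
    makes it satisfy the boundary condition.\<close>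
  define h where "h x = (if x \<in> ?S then f x else 0)" for x
  have h0: "h y = 0" if "y \<in> leaf_verts T" for y
    using that inner_leaf_partition [of T] by (auto simp: h_def)
  have "(\<Sum>y | (x, y) \<in> parcs T. h x - h y) = m * h x" if "x \<in> ?S" for x
  proof -
    have "(\<Sum>y | (x, y) \<in> parcs T. h x - h y) = (\<Sum>y\<in>?S. ?A x y * h y)"
      using that h0 by (rule dirichlet_matrix_apply)
    also have "\<dots> = (\<Sum>y\<in>?S. ?A x y * f y)"
      by (simp add: h_def)
    also have "\<dots> = m * f x"
      by (rule quadratic_form_minimizer_eigenvector [OF finite_inner dirichlet_matrix_sym low att that])
    finally show ?thesis using that by (simp add: h_def)
  qed
  moreover have "\<exists>x\<in>pverts T. h x \<noteq> 0"
    using nz inner_leaf_partition(1) [of T] by (auto simp: h_def)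
  ultimately have m: "dirichlet_eigenvalue T m"
    unfolding dirichlet_eigenvalue_def using h0 by blast
  have "m \<le> l" if l: "dirichlet_eigenvalue T l" for l
  proof -
    obtain g where g: "\<exists>x\<in>pverts T. g x \<noteq> 0" "\<forall>x\<in>leaf_verts T. g x = 0"
      "\<forall>x\<in>?S. (\<Sum>y | (x, y) \<in> parcs T. g x - g y) = l * g x"
      using l unfolding dirichlet_eigenvalue_def by blast
    have "dirichlet_form T g = l * (\<Sum>x\<in>?S. (g x)\<^sup>2)"
      unfolding dirichlet_form_def using g(3) by (simp add: sum_distrib_left power2_eq_square mult_ac)
    then have "m * (\<Sum>x\<in>?S. (g x)\<^sup>2) \<le> l * (\<Sum>x\<in>?S. (g x)\<^sup>2)"
      using low [of g] form [of g] g(2) by simp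
    moreover have "\<exists>x\<in>?S. g x \<noteq> 0"
      using g(1,2) inner_leaf_partition(1) [of T] by blast
    then have "(\<Sum>x\<in>?S. (g x)\<^sup>2) > 0"
      by (metis (no_types, lifting) finite_inner sum_nonneg_eq_0_iff sum_nonneg less_eq_real_def
          zero_le_power2 zero_eq_power2)
    ultimately show ?thesis by simp
  qed
  with m have lam: "dirichlet_lambda1 T = m"
    unfolding dirichlet_lambda1_def by (intro Least_equality) auto
  show "dirichlet_eigenvalue T (dirichlet_lambda1 T)" using m lam by simp
  show "dirichlet_lambda1 T * (\<Sum>x\<in>?S. (f x)\<^sup>2) \<le> dirichlet_form T f"
    if "\<And>y. y \<in> leaf_verts T \<Longrightarrow> f y = 0" for f
    using low [of f] form [of f, OF that] lam by simp
  show "(\<Sum>y | (x, y) \<in> parcs T. f x - f y) = dirichlet_lambda1 T * f x"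
    if f: "\<And>y. y \<in> leaf_verts T \<Longrightarrow> f y = 0"
      and e: "dirichlet_form T f = dirichlet_lambda1 T * (\<Sum>x\<in>?S. (f x)\<^sup>2)" and x: "x \<in> ?S"
    for f x
    using quadratic_form_minimizer_eigenvector [OF finite_inner dirichlet_matrix_sym low _ x, of f]
      e form [of f, OF f] lam dirichlet_matrix_apply [of x f, OF x f] by simp
qed

end

section \<open>Two-valued test functions and the extremal star\<close>

text \<open>The link between analysis and isomorphism: for the given numbers of leaves and interior
  vertices, the existence of such a \<open>c\<close> is shown equivalent both to equality in the
  bound and to isomorphism with the star-like tree. The interior neighbours of \<open>c\<close>
  follow by symmetry.\<close>

definition inner_star :: "'a pair_pre_digraph \<Rightarrow> nat \<Rightarrow> 'a \<Rightarrow> bool" where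
  "inner_star T a c \<longleftrightarrow> c \<in> inner_verts T \<and> card (pendants T c) = a \<and>
     (\<forall>x\<in>inner_verts T - {c}. inner_nbrs T x = {c} \<and> card (pendants T x) = a + 1)"

definition two_level :: "'a pair_pre_digraph \<Rightarrow> 'a \<Rightarrow> real \<Rightarrow> 'a \<Rightarrow> real" where
  "two_level T c t x = (if x = c then 1 else if x \<in> inner_verts T then t else 0)"

text \<open>A triangle is a cycle of length 3, just long enough to be forbidden. This excludes edges
  between two neighbours of the centre in the equality case.\<close>

lemma graph_tree_no_triangle:
  assumes "graph_tree T" "(x, y) \<in> parcs T" "(y, z) \<in> parcs T" "(z, x) \<in> parcs T"
  shows False
proof -
  interpret G: pair_graph T using assms(1) by (simp add: graph_tree_def)
  have "x \<noteq> y" "y \<noteq> z" "z \<noteq> x" "x \<in> pverts T"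
    using assms(2-4) G.no_loops' G.in_arcsD1 by blast+
  then have "pre_digraph.cycle (with_proj T) [(x, y), (y, z), (z, x)]"
    using assms(2-4)
    by (auto simp: pre_digraph.cycle_def pre_digraph.awalk_def cas_with_proj_eq
        awalk_verts_with_proj_eq)
  then show False using assms(1) unfolding graph_tree_def by force
qed

text \<open>With \<open>d = k - 1\<close>, the bound of the theorem is \<open>a + \<nu>\<close>,
  where \<nu> is the smaller root of \<open>(2 - x) * (d - x) = d\<close>, a quadratic with
  discriminant \<open>d\<^sup>2 + 4\<close>. This equation results from eliminating the non-central
  values in the eigenvalue equations of the extremal tree.\<close>

lemma star_root:
  fixes d :: real
  assumes "d \<ge> 1"
  defines "\<nu> \<equiv> (d + 2 - sqrt (d\<^sup>2 + 4)) / 2"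
  shows "0 < \<nu>" "\<nu> < 1" "(2 - \<nu>) * (d - \<nu>) = d"
proof -
  have sq: "(sqrt (d\<^sup>2 + 4))\<^sup>2 = d\<^sup>2 + 4" by simp
  have "sqrt (d\<^sup>2 + 4) < d + 2"
    using assms by (intro real_less_lsqrt) (auto simp: power2_eq_square algebra_simps)
  then show "0 < \<nu>" by (simp add: \<nu>_def)
  have "d < sqrt (d\<^sup>2 + 4)" by (rule real_less_rsqrt) simp
  then show "\<nu> < 1" by (simp add: \<nu>_def)
  show "(2 - \<nu>) * (d - \<nu>) = d"
    using sq unfolding \<nu>_def by (simp add: field_simps power2_eq_square)
qed

context simple_graph
begin

interpretation G: pair_graph T by (fact graph)

lemma sum_two_level_center:
  assumes "c \<in> inner_verts T"
  shows "(\<Sum>y | (c, y) \<in> parcs T. two_level T c t c - two_level T c t y) =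
    real (card (inner_nbrs T c)) * (1 - t) + real (card (pendants T c))"
proof -
  have "(\<Sum>y\<in>inner_nbrs T c. two_level T c t c - two_level T c t y) = (\<Sum>y\<in>inner_nbrs T c. 1 - t)"
    by (intro sum.cong) (auto simp: two_level_def inner_nbrs_def dest: G.no_loops')
  moreover have "(\<Sum>y\<in>pendants T c. two_level T c t c - two_level T c t y) = (\<Sum>y\<in>pendants T c. 1)"
    using assms inner_leaf_partition [of T]
    by (intro sum.cong) (auto simp: two_level_def pendants_def)
  ultimately show ?thesis by (simp add: sum_nbrs)
qed

lemma sum_two_level_other:
  assumes "c \<in> inner_verts T" "x \<in> inner_verts T" "x \<noteq> c"
  shows "(\<Sum>y | (x, y) \<in> parcs T. two_level T c t x - two_level T c t y) =
    (if (c, x) \<in> parcs T then t - 1 else 0) + real (card (pendants T x)) * t"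
proof -
  have "(\<Sum>y\<in>inner_nbrs T x. two_level T c t x - two_level T c t y) =
      (\<Sum>y\<in>inner_nbrs T x. if y = c then t - 1 else 0)"
    using assms by (intro sum.cong) (auto simp: two_level_def inner_nbrs_def)
  also have "\<dots> = (if (c, x) \<in> parcs T then t - 1 else 0)"
    using assms by (auto simp: inner_nbrs_def dest: G.arcs_symmetric)
  finally have "(\<Sum>y\<in>inner_nbrs T x. two_level T c t x - two_level T c t y) = \<dots>" .
  moreover have "(\<Sum>y\<in>pendants T x. two_level T c t x - two_level T c t y) = (\<Sum>y\<in>pendants T x. t)"
    using assms inner_leaf_partition [of T]
    by (intro sum.cong) (auto simp: two_level_def pendants_def)
  ultimately show ?thesis by (simp add: sum_nbrs)
qed

lemma sum_two_level_sq:
  assumes "c \<in> inner_verts T"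
  shows "(\<Sum>x\<in>inner_verts T. (two_level T c t x)\<^sup>2) = 1 + (real (card (inner_verts T)) - 1) * t\<^sup>2"
proof -
  have "card (inner_verts T) > 0" using assms by (auto simp: card_gt_0_iff)
  moreover have "(\<Sum>x\<in>inner_verts T - {c}. (two_level T c t x)\<^sup>2) = (\<Sum>x\<in>inner_verts T - {c}. t\<^sup>2)"
    by (intro sum.cong) (auto simp: two_level_def)
  ultimately show ?thesis
    using assms by (simp add: sum.remove [of _ c] two_level_def of_nat_diff)
qed

text \<open>Edges between non-central interior vertices contribute nothing, since the values agree.
  An edge from \<open>c\<close> to an interior vertex contributes \<open>1 - t\<close> at
  \<open>c\<close> and \<open>t * (t - 1)\<close> at the other end, together
  \<open>(1 - t)\<^sup>2\<close>. An edge to a leaf contributes 1 at \<open>c\<close> and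
  \<open>t\<^sup>2\<close> elsewhere.\<close>

lemma dirichlet_form_two_level:
  assumes c: "c \<in> inner_verts T"
  shows "dirichlet_form T (two_level T c t) =
    real (card (inner_nbrs T c)) * (1 - t)\<^sup>2 + real (card (pendants T c))
    + t\<^sup>2 * ((\<Sum>x\<in>inner_verts T. real (card (pendants T x))) - real (card (pendants T c)))"
proof -
  let ?S = "inner_verts T"
  have nb: "inner_nbrs T c = {x \<in> ?S - {c}. (c, x) \<in> parcs T}"
    by (auto simp: inner_nbrs_def dest: G.no_loops')
  have "(\<Sum>x\<in>?S - {c}. two_level T c t x * (\<Sum>y | (x, y) \<in> parcs T. two_level T c t x - two_level T c t y)) =
      (\<Sum>x\<in>?S - {c}. (if (c, x) \<in> parcs T then t * (t - 1) else 0) + t\<^sup>2 * real (card (pendants T x)))"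
  proof (intro sum.cong refl)
    fix x assume x: "x \<in> ?S - {c}"
    have "two_level T c t x * (\<Sum>y | (x, y) \<in> parcs T. two_level T c t x - two_level T c t y) =
        t * ((if (c, x) \<in> parcs T then t - 1 else 0) + real (card (pendants T x)) * t)"
      using c x by (intro arg_cong2 [where f = "(*)"] sum_two_level_other) (auto simp: two_level_def)
    then show "two_level T c t x * (\<Sum>y | (x, y) \<in> parcs T. two_level T c t x - two_level T c t y) =
        (if (c, x) \<in> parcs T then t * (t - 1) else 0) + t\<^sup>2 * real (card (pendants T x))"
      by (simp add: power2_eq_square algebra_simps)
  qed
  moreover have "(\<Sum>x\<in>?S - {c}. if (c, x) \<in> parcs T then t * (t - 1) else 0) =
      real (card (inner_nbrs T c)) * (t * (t - 1))"
    unfolding nb by (simp add: sum.If_cases Int_def)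
  moreover have "(\<Sum>x\<in>?S - {c}. real (card (pendants T x))) =
      (\<Sum>x\<in>?S. real (card (pendants T x))) - real (card (pendants T c))"
    using c by (simp add: sum_diff1)
  ultimately have "(\<Sum>x\<in>?S - {c}. two_level T c t x *
      (\<Sum>y | (x, y) \<in> parcs T. two_level T c t x - two_level T c t y)) =
      real (card (inner_nbrs T c)) * (t * (t - 1))
      + t\<^sup>2 * ((\<Sum>x\<in>?S. real (card (pendants T x))) - real (card (pendants T c)))"
    by (simp add: sum.distrib sum_distrib_left [symmetric])
  moreover have "two_level T c t c * (\<Sum>y | (c, y) \<in> parcs T. two_level T c t c - two_level T c t y) =
      real (card (inner_nbrs T c)) * (1 - t) + real (card (pendants T c))"
    unfolding sum_two_level_center [OF c] by (simp add: two_level_def)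
  ultimately show ?thesis
    unfolding dirichlet_form_def using c
    by (simp add: sum.remove [of _ c] power2_eq_square algebra_simps)
qed

lemma inner_nbrs_bound:
  assumes "c \<in> inner_verts T"
  shows "inner_nbrs T c \<subseteq> inner_verts T - {c}"
    and "card (inner_nbrs T c) \<le> card (inner_verts T) - 1"
proof -
  show sub: "inner_nbrs T c \<subseteq> inner_verts T - {c}"
    by (auto simp: inner_nbrs_def dest: G.no_loops')
  show "card (inner_nbrs T c) \<le> card (inner_verts T) - 1"
    using card_mono [OF _ sub] assms by simp
qed

lemma dirichlet_lambda1_le_star:
  fixes a :: nat and d \<nu> :: real
  defines "d \<equiv> real (card (inner_verts T)) - 1"
  defines "\<nu> \<equiv> (d + 2 - sqrt (d\<^sup>2 + 4)) / 2"
  assumes two: "card (inner_verts T) \<ge> 2"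
    and leaves: "card (leaf_verts T) = a * card (inner_verts T) + card (inner_verts T) - 1"
  shows "dirichlet_lambda1 T \<le> a + \<nu>"
    and "\<lbrakk>dirichlet_lambda1 T = a + \<nu>; graph_tree T\<rbrakk> \<Longrightarrow> \<exists>c. inner_star T a c"
proof -
  let ?S = "inner_verts T"
  let ?k = "card ?S"
  let ?l = "\<lambda>x. card (pendants T x)"
  define L where "L = (\<Sum>x\<in>?S. real (?l x))"
  have d: "d \<ge> 1" using two by (simp add: d_def)
  note nu = star_root [OF d, folded \<nu>_def]
  have ne: "?S \<noteq> {}" using two by auto
  have b: "real (card (leaf_verts T)) = a + d * (a + 1)"
    using two by (simp add: leaves d_def of_nat_diff algebra_simps)
  have L: "L \<le> a + d * (a + 1)"
    using sum_card_pendants_le unfolding b [symmetric] L_def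
    by (metis of_nat_le_iff of_nat_sum)
  have "\<exists>c\<in>?S. ?l c \<le> a"
  proof (rule ccontr)
    assume "\<not> ?thesis"
    then have "(\<Sum>x\<in>?S. a + 1) \<le> (\<Sum>x\<in>?S. ?l x)" by (intro sum_mono) force
    also have "\<dots> \<le> card (leaf_verts T)" by (rule sum_card_pendants_le)
    finally show False using two by (simp add: leaves algebra_simps)
  qed
  then obtain c where c: "c \<in> ?S" and lc: "?l c \<le> a" by blast
  define D where "D = real (card (inner_nbrs T c))"
  have D: "D \<le> d"
    using inner_nbrs_bound(2) [OF c] two unfolding D_def d_def by linarith
  \<comment> \<open>The eigenvalue equations of the extremal tree for \<open>a + \<nu>\<close> read
    \<open>d * (1 - t) = \<nu>\<close> at the centre and \<open>(2 - \<nu>) * t = 1\<close> at the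
    other interior vertices. The first determines \<open>t\<close>; the second is then the quadratic
    equation for \<nu>.\<close>
  define t where "t = 1 - \<nu> / d"
  define N where "N = 1 + d * t\<^sup>2"
  have t: "0 < t" "t < 1" "d * (1 - t) = \<nu>" "(2 - \<nu>) * t = 1"
    using nu d by (simp_all add: t_def field_simps)
  have N: "N > 0" using d by (simp add: N_def add_pos_nonneg)
  \<comment> \<open>The left side is the Dirichlet form in the extremal configuration, where
    \<open>N\<close> is the squared norm, so the Rayleigh quotient there is exactly the
    bound.\<close>
  have key: "d * (1 - t)\<^sup>2 + a + t\<^sup>2 * (d * (a + 1)) = (a + \<nu>) * N"
  proof -
    have "\<nu> = d * t * (1 - \<nu>)"
    proof -
      have "(1 - \<nu>) * t = 1 - t" using t(4) by (simp add: algebra_simps)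
      then show ?thesis using t(3) by (metis mult.assoc mult.commute)
    qed
    then have "\<nu> * t = d * t\<^sup>2 * (1 - \<nu>)"
      by (metis mult.assoc mult.commute power2_eq_square)
    moreover have "d * (1 - t)\<^sup>2 = \<nu> * (1 - t)"
      using t(3) by (metis mult.assoc power2_eq_square)
    ultimately show ?thesis by (simp add: N_def algebra_simps)
  qed
  have v0: "two_level T c t y = 0" if "y \<in> leaf_verts T" for y
    using that c inner_leaf_partition [of T] by (auto simp: two_level_def)
  have sq: "(\<Sum>x\<in>?S. (two_level T c t x)\<^sup>2) = N"
    using sum_two_level_sq [OF c] by (simp add: N_def d_def)
  \<comment> \<open>The deviation from the extremal configuration splits into three nonnegative
    terms: interior vertices not adjacent to \<open>c\<close>, leaves that \<open>c\<close> has
    fewer than \<open>a\<close>, and leaves attached to no interior vertex.\<close>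
  have gap: "(a + \<nu>) * N - dirichlet_form T (two_level T c t) =
      (d - D) * (1 - t)\<^sup>2 + (a - ?l c) * (1 - t\<^sup>2) + t\<^sup>2 * (a + d * (a + 1) - L)"
    unfolding dirichlet_form_two_level [OF c] key [symmetric] D_def [symmetric] L_def [symmetric]
    using lc by (simp add: algebra_simps of_nat_diff)
  have t2: "t\<^sup>2 < 1" using t by (simp add: abs_square_less_1)
  have pos: "0 \<le> (d - D) * (1 - t)\<^sup>2" "0 \<le> (a - ?l c) * (1 - t\<^sup>2)"
      "0 \<le> t\<^sup>2 * (a + d * (a + 1) - L)"
    using D lc L t2 by simp_all
  have low: "dirichlet_lambda1 T * N \<le> dirichlet_form T (two_level T c t)"
    using dirichlet_lambda1_variational(2) [OF ne, of "two_level T c t", OF v0] sq by simp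
  then have "dirichlet_lambda1 T * N \<le> (a + \<nu>) * N"
    using gap pos by linarith
  then show "dirichlet_lambda1 T \<le> a + \<nu>"
    using N by simp
  assume eq: "dirichlet_lambda1 T = a + \<nu>" and tree: "graph_tree T"
  have low': "(a + \<nu>) * N \<le> dirichlet_form T (two_level T c t)"
    using low eq by simp
  \<comment> \<open>Nonnegative terms with nonpositive sum vanish. As \<open>0 < t < 1\<close>, the
    factors \<open>(1 - t)\<^sup>2\<close> and \<open>1 - t\<^sup>2\<close> are positive, so
    \<open>D = d\<close> and \<open>c\<close> has exactly \<open>a\<close> leaves.\<close>
  have zero: "(d - D) * (1 - t)\<^sup>2 = 0" "(a - ?l c) * (1 - t\<^sup>2) = 0"
    using gap pos low' by linarith+
  have att: "dirichlet_form T (two_level T c t) = dirichlet_lambda1 T * (\<Sum>x\<in>?S. (two_level T c t x)\<^sup>2)"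
    using gap pos low' sq eq by simp
  have "D = d" using zero(1) t by simp
  then have "card (inner_nbrs T c) = card (?S - {c})"
    using two c unfolding D_def d_def by (simp add: of_nat_diff)
  then have nb: "inner_nbrs T c = ?S - {c}"
    using inner_nbrs_bound(1) [OF c] by (intro card_subset_eq) auto
  have "?l c = a" using zero(2) t2 lc by simp
  moreover have "inner_nbrs T x = {c} \<and> ?l x = a + 1" if x: "x \<in> ?S - {c}" for x
  proof
    have cx: "(c, x) \<in> parcs T" using x nb by (auto simp: inner_nbrs_def)
    have "y = c" if "y \<in> inner_nbrs T x" for y
    proof (rule ccontr)
      assume "y \<noteq> c"
      with that have "(c, y) \<in> parcs T" using nb by (auto simp: inner_nbrs_def)
      then show False
        using graph_tree_no_triangle [OF tree cx] that G.arcs_symmetric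
        by (auto simp: inner_nbrs_def)
    qed
    moreover have "c \<in> inner_nbrs T x"
      using c cx by (auto simp: inner_nbrs_def dest: G.arcs_symmetric)
    ultimately show "inner_nbrs T x = {c}" by blast
    \<comment> \<open>The test function attains the minimum and is therefore an eigenfunction. Its
      equation at \<open>x\<close>, with \<open>(2 - \<nu>) * t = 1\<close>, determines the number
      of leaves at \<open>x\<close>.\<close>
    have "t - 1 + real (?l x) * t = (a + \<nu>) * t"
    proof -
      have "(\<Sum>y | (x, y) \<in> parcs T. two_level T c t x - two_level T c t y) = (a + \<nu>) * two_level T c t x"
        using dirichlet_lambda1_variational(3) [OF ne, of "two_level T c t" x, OF v0 att] x eq by simp
      moreover have "two_level T c t x = t" using x by (simp add: two_level_def)
      ultimately show ?thesis
        using sum_two_level_other [OF c, of x t] x cx by simp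
    qed
    then have "real (?l x) * t = (a + 1) * t"
      using t(4) by (simp add: algebra_simps)
    then show "?l x = a + 1" using t(1) by simp
  qed
  ultimately show "\<exists>c. inner_star T a c"
    using c by (auto simp: inner_star_def)
qed

lemma inner_star_center_nbrs:
  assumes "inner_star T a c"
  shows "inner_nbrs T c = inner_verts T - {c}"
proof
  show "inner_nbrs T c \<subseteq> inner_verts T - {c}"
    using assms by (intro inner_nbrs_bound) (simp add: inner_star_def)
  show "inner_verts T - {c} \<subseteq> inner_nbrs T c"
  proof
    fix x assume x: "x \<in> inner_verts T - {c}"
    then have "c \<in> inner_nbrs T x" using assms by (auto simp: inner_star_def)
    then show "x \<in> inner_nbrs T c"
      using x by (auto simp: inner_nbrs_def dest: G.arcs_symmetric)
  qed
qed

text \<open>If the first eigenvalue were \<open>a + \<kappa>\<close> with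
  \<open>\<kappa> < \<nu>\<close>, eliminating the non-central values of its eigenfunction would
  give \<open>(2 - \<kappa>) * (d - \<kappa>) = d\<close>. But \<nu> is the smallest root.\<close>

lemma inner_star_lambda1_ge:
  fixes a :: nat and d \<nu> :: real
  defines "d \<equiv> real (card (inner_verts T)) - 1"
  defines "\<nu> \<equiv> (d + 2 - sqrt (d\<^sup>2 + 4)) / 2"
  assumes two: "card (inner_verts T) \<ge> 2" and star: "inner_star T a c"
  shows "a + \<nu> \<le> dirichlet_lambda1 T"
proof (rule ccontr)
  let ?S = "inner_verts T"
  assume neg: "\<not> a + \<nu> \<le> dirichlet_lambda1 T"
  define \<kappa> where "\<kappa> = dirichlet_lambda1 T - a"
  have less: "\<kappa> < \<nu>" using neg by (simp add: \<kappa>_def)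
  have d: "d \<ge> 1" using two by (simp add: d_def)
  note nu = star_root [OF d, folded \<nu>_def]
  have ne: "?S \<noteq> {}" using two by auto
  have c: "c \<in> ?S" using star by (simp add: inner_star_def)
  obtain f where f: "\<exists>x\<in>pverts T. f x \<noteq> 0" "\<forall>x\<in>leaf_verts T. f x = 0"
    "\<forall>x\<in>?S. (\<Sum>y | (x, y) \<in> parcs T. f x - f y) = (a + \<kappa>) * f x"
    using dirichlet_lambda1_variational(1) [OF ne] unfolding dirichlet_eigenvalue_def \<kappa>_def by auto
  have row: "(\<Sum>y\<in>inner_nbrs T x. f x - f y) + card (pendants T x) * f x = (a + \<kappa>) * f x"
    if "x \<in> ?S" for x
  proof -
    have "(\<Sum>y\<in>pendants T x. f x - f y) = (\<Sum>y\<in>pendants T x. f x)"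
      using f(2) by (intro sum.cong) (auto simp: pendants_def)
    then show ?thesis using bspec [OF f(3) that] by (simp add: sum_nbrs)
  qed
  have other: "(2 - \<kappa>) * f x = f c" if "x \<in> ?S - {c}" for x
  proof -
    have "(f x - f c) + (a + 1) * f x = (a + \<kappa>) * f x"
      using row [of x] star that by (simp add: inner_star_def)
    then show ?thesis by (simp add: algebra_simps)
  qed
  \<comment> \<open>Since \<open>\<kappa> < \<nu> < 1\<close>, the factor
    \<open>2 - \<kappa>\<close> is nonzero, so \<open>f c = 0\<close> would force \<open>f\<close>
    to vanish at every interior vertex.\<close>
  have "f c \<noteq> 0"
  proof
    assume "f c = 0"
    then have "f x = 0" if "x \<in> ?S" for x
      using other [of x] that less nu by (cases "x = c") auto
    then show False using f(1,2) inner_leaf_partition(1) [of T] by blast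
  qed
  have "(\<Sum>y\<in>?S - {c}. f c - f y) + a * f c = (a + \<kappa>) * f c"
    using row [OF c] star by (simp add: inner_star_center_nbrs [OF star] inner_star_def)
  then have "(\<Sum>y\<in>?S - {c}. f c - f y) = \<kappa> * f c"
    by (simp add: algebra_simps)
  then have "(2 - \<kappa>) * (\<kappa> * f c) = (\<Sum>y\<in>?S - {c}. (2 - \<kappa>) * (f c - f y))"
    by (metis sum_distrib_left)
  also have "\<dots> = (\<Sum>y\<in>?S - {c}. (1 - \<kappa>) * f c)"
    by (intro sum.cong) (simp_all add: right_diff_distrib other, simp add: algebra_simps)
  also have "\<dots> = d * ((1 - \<kappa>) * f c)"
    using c two by (simp add: d_def of_nat_diff)
  finally have "((2 - \<kappa>) * (d - \<kappa>)) * f c = d * f c"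
    by (simp add: algebra_simps)
  then have "(2 - \<kappa>) * (d - \<kappa>) = d"
    using \<open>f c \<noteq> 0\<close> by simp
  \<comment> \<open>Both factors are positive at \<nu> and strictly decreasing.\<close>
  moreover have "(2 - \<nu>) * (d - \<nu>) < (2 - \<kappa>) * (d - \<kappa>)"
    using less nu d by (intro mult_strict_mono) auto
  ultimately show False using nu(3) by simp
qed

end

section \<open>Recognising the star-like tree\<close>

text \<open>\<open>digraph_iso\<close> allows separate maps on arcs and new head and tail functions.
  As arcs are pairs on both sides, head and tail must be the projections, and the vertex map
  determines the arc map.\<close>

lemma digraph_iso_with_proj_iff:
  assumes "pair_wf_digraph G"
  shows "digraph_iso (with_proj G) (with_proj H) \<longleftrightarrow>
    (\<exists>h. inj_on h (pverts G) \<and> pverts H = h ` pverts G \<and> parcs H = map_prod h h ` parcs G)"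
proof
  assume "digraph_iso (with_proj G) (with_proj H)"
  then obtain f where f: "pre_digraph.digraph_isomorphism (with_proj G) f"
    and H: "with_proj H = app_iso f (with_proj G)"
    unfolding digraph_iso_def by blast
  have tail: "iso_tail f = fst" and head: "iso_head f = snd"
    using arg_cong [OF H, of tail] arg_cong [OF H, of head] by simp_all
  have "iso_arcs f e = map_prod (iso_verts f) (iso_verts f) e" if "e \<in> parcs G" for e
    using f that unfolding pre_digraph.digraph_isomorphism_def tail head
    by (auto simp: prod_eq_iff)
  then have "iso_arcs f ` parcs G = map_prod (iso_verts f) (iso_verts f) ` parcs G"
    by (rule image_cong [OF refl])
  then have "parcs H = map_prod (iso_verts f) (iso_verts f) ` parcs G"
    using arg_cong [OF H, of arcs] by simp
  moreover have "pverts H = iso_verts f ` pverts G"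
    using arg_cong [OF H, of verts] by simp
  moreover have "inj_on (iso_verts f) (pverts G)"
    using f by (simp add: pre_digraph.digraph_isomorphism_def)
  ultimately show "\<exists>h. inj_on h (pverts G) \<and> pverts H = h ` pverts G \<and> parcs H = map_prod h h ` parcs G"
    by blast
next
  assume "\<exists>h. inj_on h (pverts G) \<and> pverts H = h ` pverts G \<and> parcs H = map_prod h h ` parcs G"
  then obtain h where h: "inj_on h (pverts G)" "pverts H = h ` pverts G"
    "parcs H = map_prod h h ` parcs G" by blast
  interpret G: pair_wf_digraph G by fact
  let ?f = "\<lparr>iso_verts = h, iso_arcs = map_prod h h, iso_head = snd, iso_tail = fst\<rparr>"
  have "inj_on (map_prod h h) (parcs G)"
    using map_prod_inj_on [OF h(1) h(1)] by (rule inj_on_subset) (auto dest: G.wellformed')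
  then have "pre_digraph.digraph_isomorphism (with_proj G) ?f"
    using h(1) assms by (simp add: pre_digraph.digraph_isomorphism_def wf_digraph_wp_iff)
  moreover have "with_proj H = app_iso ?f (with_proj G)"
    using h(2,3) by (simp add: app_iso_def with_proj_def)
  ultimately show "digraph_iso (with_proj G) (with_proj H)"
    unfolding digraph_iso_def by blast
qed

lemma slp_core_star: "slp_core 0 d 0 = insert (Spine 0) (Left_Nbr ` {1..d})"
  by (simp add: slp_core_def)

lemma card_slp_core_star: "card (slp_core 0 d 0) = d + 1"
  unfolding slp_core_star by (subst card_insert_disjoint) (auto simp: card_image inj_on_def)

lemma slp_pendants_star: "slp_pendants p q 0 v = (if v = Spine 0 then p else q)"
  by (simp add: slp_pendants_def)

lemma slp_edges_star:
  "slp_edges p q 0 d 0 = Pair (Spine 0) ` Left_Nbr ` {1..d} \<union>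
     {(v, Pendant v m) | v m. v \<in> slp_core 0 d 0 \<and> m \<in> {1..slp_pendants p q 0 v}}"
  by (auto simp: slp_edges_def)

lemma slp_core_Pendant: "Pendant v m \<notin> slp_core c d e"
  by (auto simp: slp_core_def)

lemma SLP_star_arc_iff:
  "(v, w) \<in> parcs (SLP p q 0 d 0) \<longleftrightarrow>
     (v = Spine 0 \<and> w \<in> Left_Nbr ` {1..d}) \<or> (w = Spine 0 \<and> v \<in> Left_Nbr ` {1..d}) \<or>
     (v \<in> slp_core 0 d 0 \<and> (\<exists>m\<in>{1..slp_pendants p q 0 v}. w = Pendant v m)) \<or>
     (w \<in> slp_core 0 d 0 \<and> (\<exists>m\<in>{1..slp_pendants p q 0 w}. v = Pendant w m))"
  by (auto simp: SLP_def slp_edges_star)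

text \<open>A vertex mapped outside the core is a pendant of the model, hence a leaf. So the
  interior lies in the preimage \<open>I\<close> of the core, and both have \<open>k\<close>
  elements. The count matters: for \<open>a = 0\<close> and \<open>k = 2\<close> the core vertex
  \<open>Spine 0\<close> is itself a leaf of the model.\<close>

lemma (in simple_graph) iso_SLP_imp_inner_star:
  assumes k: "card (inner_verts T) = k" "k \<ge> 1"
    and iso: "digraph_iso (with_proj T) (with_proj (SLP a (a + 1) 0 (k - 1) 0))"
  shows "\<exists>c. inner_star T a c"
proof -
  interpret G: pair_graph T by (fact graph)
  let ?H = "SLP a (a + 1) 0 (k - 1) 0"
  let ?C = "slp_core 0 (k - 1) 0"
  obtain h where inj: "inj_on h (pverts T)" and V: "pverts ?H = h ` pverts T"
    and E: "parcs ?H = map_prod h h ` parcs T"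
    using iffD1 [OF digraph_iso_with_proj_iff [OF G.pair_wf_digraph] iso] by (elim exE conjE) (rule that)
  have arc: "(x, y) \<in> parcs T \<longleftrightarrow> (h x, h y) \<in> parcs ?H" if "x \<in> pverts T" "y \<in> pverts T" for x y
  proof
    assume "(h x, h y) \<in> parcs ?H"
    then obtain x' y' where "(x', y') \<in> parcs T" "h x' = h x" "h y' = h y"
      unfolding E by auto
    then show "(x, y) \<in> parcs T"
      using that inj by (metis G.in_arcsD1 G.in_arcsD2 inj_onD)
  next
    assume "(x, y) \<in> parcs T"
    then show "(h x, h y) \<in> parcs ?H" unfolding E by (rule rev_image_eqI) simp
  qed
  define I where "I = {x \<in> pverts T. h x \<in> ?C}"
  have outside: "\<exists>v\<in>?C. \<exists>m\<in>{1..slp_pendants a (a + 1) 0 v}. h x = Pendant v m"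
    if "x \<in> pverts T - I" for x
  proof -
    have "h x \<in> pverts ?H" "h x \<notin> ?C" using that V by (auto simp: I_def)
    then show ?thesis by (auto simp: SLP_def)
  qed
  have "pverts T - I \<subseteq> leaf_verts T"
  proof
    fix x assume x: "x \<in> pverts T - I"
    then obtain v m where v: "v \<in> ?C" "m \<in> {1..slp_pendants a (a + 1) 0 v}" "h x = Pendant v m"
      using outside by blast
    have "v \<in> pverts ?H" using v(1) by (simp add: SLP_def)
    then obtain w where w: "w \<in> pverts T" "h w = v" unfolding V by blast
    have "(x, y) \<in> parcs T \<longleftrightarrow> y = w" if y: "y \<in> pverts T" for y
    proof -
      have "(x, y) \<in> parcs T \<longleftrightarrow> h y = v"
        using arc [of x y] x y v slp_core_Pendant by (auto simp: SLP_star_arc_iff)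
      then show ?thesis using inj w y by (auto dest: inj_onD)
    qed
    then have "{y. (x, y) \<in> parcs T} = {w}"
      using w(1) by (auto dest: G.wellformed')
    then show "x \<in> leaf_verts T" using x by (auto simp: leaf_verts_iff)
  qed
  then have sub: "inner_verts T \<subseteq> I" by (auto simp: inner_verts_def)
  have "h ` I = ?C"
    using V unfolding I_def by (auto simp: SLP_def)
  moreover have "inj_on h I" using inj by (rule inj_on_subset) (auto simp: I_def)
  ultimately have "card I = card ?C" by (metis card_image)
  then have "card I = card (inner_verts T)" using k by (simp add: card_slp_core_star)
  then have inner: "inner_verts T = I"
    using sub G.pair_finite_verts by (intro card_subset_eq) (auto simp: I_def)
  have pend: "card (pendants T x) = slp_pendants a (a + 1) 0 (h x)" if x: "x \<in> I" for x
  proof -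
    have "h ` pendants T x = Pendant (h x) ` {1..slp_pendants a (a + 1) 0 (h x)}"
    proof (intro equalityI subsetI)
      fix w assume "w \<in> h ` pendants T x"
      then obtain y where y: "w = h y" "y \<in> pverts T - I" "(x, y) \<in> parcs T"
        unfolding pendants_def inner [symmetric] by (auto simp: inner_verts_def leaf_verts_def)
      then show "w \<in> Pendant (h x) ` {1..slp_pendants a (a + 1) 0 (h x)}"
        using arc [of x y] x outside [of y] slp_core_Pendant
        by (fastforce simp: SLP_star_arc_iff I_def)
    next
      fix w assume w: "w \<in> Pendant (h x) ` {1..slp_pendants a (a + 1) 0 (h x)}"
      then have "w \<in> pverts ?H" using x by (auto simp: SLP_def I_def)
      then obtain y where y: "y \<in> pverts T" "w = h y" using V by blast
      then have "y \<notin> I" using w slp_core_Pendant by (auto simp: I_def)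
      moreover have "(x, y) \<in> parcs T"
        using arc [of x y] x y w by (auto simp: SLP_star_arc_iff I_def)
      ultimately show "w \<in> h ` pendants T x"
        using y inner unfolding pendants_def by (auto simp: inner_verts_def)
    qed
    moreover have "inj_on h (pendants T x)"
      using inj by (rule inj_on_subset) (auto simp: pendants_def leaf_verts_def)
    ultimately have "card (pendants T x) = card (Pendant (h x) ` {1..slp_pendants a (a + 1) 0 (h x)})"
      by (metis card_image)
    then show ?thesis by (simp add: card_image inj_on_def)
  qed
  have "Spine 0 \<in> h ` I" using \<open>h ` I = ?C\<close> by (simp add: slp_core_star)
  then obtain c where c: "c \<in> I" "h c = Spine 0" by auto
  have "inner_nbrs T x = {c} \<and> card (pendants T x) = a + 1" if x: "x \<in> I" "x \<noteq> c" for x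
  proof
    have hx: "h x \<noteq> Spine 0"
      using c x inj unfolding I_def by (metis (mono_tags, lifting) inj_onD mem_Collect_eq)
    then show "card (pendants T x) = a + 1"
      using pend [OF x(1)] by (simp add: slp_pendants_star)
    have hL: "h x \<in> Left_Nbr ` {1..k - 1}"
      using x hx by (auto simp: I_def slp_core_star)
    have "(x, y) \<in> parcs T \<longleftrightarrow> y = c" if y: "y \<in> I" for y
    proof -
      have "(x, y) \<in> parcs T \<longleftrightarrow> h y = Spine 0"
        using arc [of x y] x y hx hL slp_core_Pendant by (fastforce simp: SLP_star_arc_iff I_def)
      then show ?thesis
        using c y inj unfolding I_def by (metis (mono_tags, lifting) inj_onD mem_Collect_eq)
    qed
    then show "inner_nbrs T x = {c}" using c(1) unfolding inner_nbrs_def inner by auto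
  qed
  then have "inner_star T a c"
    using c pend [OF c(1)] unfolding inner_star_def inner by (simp add: slp_pendants_star)
  then show ?thesis by blast
qed

text \<open>The isomorphism sends \<open>c\<close> to \<open>Spine 0\<close>, numbers the other
  interior vertices, and numbers the leaves at each interior vertex separately.\<close>

lemma (in simple_graph) inner_star_imp_iso_SLP:
  assumes k: "card (inner_verts T) = k" "k \<ge> 1"
    and leaves: "card (leaf_verts T) = a * k + k - 1"
    and star: "inner_star T a c"
  shows "digraph_iso (with_proj T) (with_proj (SLP a (a + 1) 0 (k - 1) 0))"
proof -
  interpret G: pair_graph T by (fact graph)
  let ?H = "SLP a (a + 1) 0 (k - 1) 0"
  let ?S = "inner_verts T"
  let ?C = "slp_core 0 (k - 1) 0"
  let ?n = "slp_pendants a (a + 1) 0"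
  have c: "c \<in> ?S" using star by (simp add: inner_star_def)
  \<comment> \<open>The interior vertices already account for \<open>a + (k - 1) * (a + 1)\<close>
    leaves, which is all of them. This excludes pairs of leaves adjacent only to each other;
    connectivity is not among the assumptions of the locale.\<close>
  have "(\<Sum>x\<in>?S. card (pendants T x)) = a + (\<Sum>x\<in>?S - {c}. a + 1)"
    using star c by (simp add: sum.remove [of _ c] inner_star_def)
  also have "\<dots> = a + (k - 1) * (a + 1)"
    using k c by simp
  also have "\<dots> = a * k + k - 1"
    using k by (cases k) simp_all
  finally have "card (\<Union>x\<in>?S. pendants T x) = card (leaf_verts T)"
    by (simp add: card_UN_pendants leaves)
  then have all_pendant: "(\<Union>x\<in>?S. pendants T x) = leaf_verts T"
    by (intro card_subset_eq) (auto simp: pendants_def)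
  have "card (?S - {c}) = card {1..k - 1}" using k c by simp
  then obtain g where g: "bij_betw g (?S - {c}) {1..k - 1}"
    using finite_same_card_bij by (metis finite_Diff finite_inner finite_atLeastAtMost)
  define core where "core x = (if x = c then Spine 0 else Left_Nbr (g x))" for x
  have core_im: "core ` ?S = ?C"
  proof -
    have "core ` ?S = insert (core c) (core ` (?S - {c}))" using c by auto
    also have "core ` (?S - {c}) = Left_Nbr ` g ` (?S - {c})"
      by (auto simp: core_def image_image intro!: image_cong)
    finally show ?thesis
      using g by (simp add: slp_core_star core_def bij_betw_def)
  qed
  have core_inj: "inj_on core ?S"
    using g by (auto simp: inj_on_def core_def bij_betw_def)
  have core_n: "card (pendants T x) = ?n (core x)" if "x \<in> ?S" for x
    using star that by (auto simp: inner_star_def slp_pendants_star core_def)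
  have "\<exists>e. bij_betw e (pendants T x) {1..card (pendants T x)}" for x
    using ex_bij_betw_finite_nat [of "pendants T x"] finite_same_card_bij [of "pendants T x" "{1..card (pendants T x)}"]
    by auto
  then obtain e where e: "\<And>x. bij_betw (e x) (pendants T x) {1..card (pendants T x)}"
    by metis
  \<comment> \<open>The description is proper for a leaf attached to some vertex, as a leaf has a
    unique neighbour.\<close>
  define par where "par y = (THE x. (y, x) \<in> parcs T)" for y
  have par: "par y = x" if "y \<in> pendants T x" for x y
    unfolding par_def using that leaf_unique_nbr [of y T]
    by (intro the_equality) (auto simp: pendants_def dest: G.arcs_symmetric)
  define h where "h x = (if x \<in> ?S then core x else Pendant (core (par x)) (e (par x) x))" for x
  have h_inner: "h x = core x" if "x \<in> ?S" for x using that by (simp add: h_def)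
  have h_leaf: "h y = Pendant (core x) (e x y)" if "y \<in> pendants T x" for x y
    using that par inner_leaf_partition [of T] by (auto simp: h_def pendants_def)
  have V: "pverts T = ?S \<union> (\<Union>x\<in>?S. pendants T x)"
    using all_pendant inner_leaf_partition [of T] by simp
  have h_pend: "h ` pendants T x = Pendant (core x) ` {1..?n (core x)}" if x: "x \<in> ?S" for x
  proof -
    have "h ` pendants T x = Pendant (core x) ` e x ` pendants T x"
      by (auto simp: h_leaf image_image intro!: image_cong)
    then show ?thesis using e [of x] core_n [OF x] by (simp add: bij_betw_def)
  qed
  have "h ` pverts T = ?C \<union> (\<Union>x\<in>?S. Pendant (core x) ` {1..?n (core x)})"
    unfolding V image_Un image_UN using core_im by (simp add: h_inner h_pend)
  also have "\<dots> = ?C \<union> (\<Union>v\<in>?C. Pendant v ` {1..?n v})"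
    unfolding core_im [symmetric] by simp
  also have "\<dots> = pverts ?H" by (auto simp: SLP_def)
  finally have HV: "pverts ?H = h ` pverts T" by simp
  have inj: "inj_on h (pverts T)"
  proof (rule inj_onI)
    fix x y assume x: "x \<in> pverts T" and y: "y \<in> pverts T" and eq: "h x = h y"
    have coreP: "core z \<noteq> Pendant v m" for z v m by (simp add: core_def)
    consider "x \<in> ?S" "y \<in> ?S" | u v where "u \<in> ?S" "v \<in> ?S" "x \<in> pendants T u" "y \<in> pendants T v"
      | u where "x \<in> ?S" "y \<in> pendants T u" | u where "y \<in> ?S" "x \<in> pendants T u"
      using x y unfolding V by blast
    then show "x = y"
    proof cases
      case 1
      then show ?thesis using eq core_inj by (simp add: h_inner inj_onD)
    next
      case 2
      then have "core u = core v" "e u x = e v y" using eq by (simp_all add: h_leaf)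
      then show ?thesis
        using 2 core_inj e [of u] by (metis bij_betw_def inj_onD)
    qed (use eq coreP in \<open>metis h_inner h_leaf\<close>)+
  qed
  \<comment> \<open>One orientation of each edge, outwards from the centre as in
    \<open>slp_edges\<close>; the arcs are \<open>F\<close> and its converse because non-central
    interior vertices are pairwise nonadjacent.\<close>
  define F where "F = Pair c ` (?S - {c}) \<union> (\<Union>x\<in>?S. Pair x ` pendants T x)"
  have "parcs T = F \<union> F\<inverse>"
  proof (intro equalityI subsetI)
    fix p assume p: "p \<in> parcs T"
    obtain x y where [simp]: "p = (x, y)" by fastforce
    have xy: "(x, y) \<in> parcs T" "(y, x) \<in> parcs T" using p by (auto dest: G.arcs_symmetric)
    consider "x \<in> leaf_verts T" | "y \<in> leaf_verts T" | "x \<in> ?S" "y \<in> ?S"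
      using xy inner_leaf_partition [of T] by (blast dest: G.wellformed')
    then show "p \<in> F \<union> F\<inverse>"
    proof cases
      case 1
      then obtain u where u: "u \<in> ?S" "x \<in> pendants T u" using all_pendant by blast
      then have "u = y" using leaf_unique_nbr [of x T u y] xy by (auto simp: pendants_def dest: G.arcs_symmetric)
      then show ?thesis using u by (auto simp: F_def)
    next
      case 2
      then obtain u where u: "u \<in> ?S" "y \<in> pendants T u" using all_pendant by blast
      then have "u = x" using leaf_unique_nbr [of y T u x] xy by (auto simp: pendants_def dest: G.arcs_symmetric)
      then show ?thesis using u by (auto simp: F_def)
    next
      case 3
      have "x = c \<or> y = c"
      proof (rule ccontr)
        assume "\<not> ?thesis"
        then have "inner_nbrs T x = {c}" "y \<noteq> c" using star 3 by (auto simp: inner_star_def)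
        moreover have "y \<in> inner_nbrs T x" using 3 xy by (simp add: inner_nbrs_def)
        ultimately show False by simp
      qed
      then show ?thesis using 3 xy G.no_loops' by (auto simp: F_def)
    qed
  next
    have "F \<subseteq> parcs T"
      using inner_star_center_nbrs [OF star] by (auto simp: F_def pendants_def inner_nbrs_def)
    then show "p \<in> parcs T" if "p \<in> F \<union> F\<inverse>" for p
      using that by (auto dest: G.arcs_symmetric)
  qed
  moreover have "map_prod h h ` F = slp_edges a (a + 1) 0 (k - 1) 0"
  proof -
    have "map_prod h h ` Pair c ` (?S - {c}) = Pair (Spine 0) ` Left_Nbr ` g ` (?S - {c})"
      using c by (auto simp: image_image h_inner core_def intro!: image_cong)
    moreover have "map_prod h h ` Pair x ` pendants T x =
        Pair (core x) ` Pendant (core x) ` {1..?n (core x)}" if "x \<in> ?S" for x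
      unfolding h_pend [OF that, symmetric] using that by (simp add: image_image h_inner)
    ultimately have "map_prod h h ` F = Pair (Spine 0) ` Left_Nbr ` {1..k - 1} \<union>
        (\<Union>x\<in>?S. Pair (core x) ` Pendant (core x) ` {1..?n (core x)})"
      unfolding F_def image_Un image_UN using g by (simp add: bij_betw_def)
    also have "(\<Union>x\<in>?S. Pair (core x) ` Pendant (core x) ` {1..?n (core x)}) =
        (\<Union>v\<in>?C. Pair v ` Pendant v ` {1..?n v})"
      unfolding core_im [symmetric] by simp
    finally show ?thesis by (auto simp: slp_edges_star)
  qed
  moreover have "map_prod h h ` (F\<inverse>) = (map_prod h h ` F)\<inverse>" by force
  ultimately have HE: "parcs ?H = map_prod h h ` parcs T"
    by (simp add: image_Un SLP_def)
  show ?thesis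
    unfolding digraph_iso_with_proj_iff [OF G.pair_wf_digraph] using inj HV HE by blast
qed

theorem theorem3p7:
  fixes T :: "'a pair_pre_digraph" and a k b :: nat
  assumes "k \<ge> 2"
    and "b = a * k + k - 1"
    and "graph_tree T"
    and "card (inner_verts T) = k"
    and "card (leaf_verts T) = b"
  shows "dirichlet_lambda1 T
           \<le> (real k + 2 * real a + 1 - sqrt ((real k - 1)\<^sup>2 + 4)) / 2
         \<and> (dirichlet_lambda1 T
              = (real k + 2 * real a + 1 - sqrt ((real k - 1)\<^sup>2 + 4)) / 2
            \<longleftrightarrow> digraph_iso (with_proj T) (with_proj (SLP a (a + 1) 0 (k - 1) 0)))"
proof -
  have "simple_graph T" using assms(3) by (simp add: simple_graph_def graph_tree_def)
  then interpret simple_graph T .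
  define \<nu> where "\<nu> = ((real k - 1) + 2 - sqrt ((real k - 1)\<^sup>2 + 4)) / 2"
  have \<mu>: "(real k + 2 * real a + 1 - sqrt ((real k - 1)\<^sup>2 + 4)) / 2 = a + \<nu>"
    by (simp add: \<nu>_def field_simps)
  have two: "card (inner_verts T) \<ge> 2"
    and leaves: "card (leaf_verts T) = a * card (inner_verts T) + card (inner_verts T) - 1"
    using assms by simp_all
  note upper = dirichlet_lambda1_le_star [OF two leaves, unfolded assms(4), folded \<nu>_def]
  note lower = inner_star_lambda1_ge [OF two, unfolded assms(4), folded \<nu>_def]
  \<comment> \<open>The equality case of \<open>upper\<close> gives one direction; for a star,
    \<open>lower\<close> and the bound in \<open>upper\<close> meet.\<close>
  have "dirichlet_lambda1 T = a + \<nu> \<longleftrightarrow> (\<exists>c. inner_star T a c)"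
    using upper lower assms(3) by (meson order_antisym)
  also have "\<dots> \<longleftrightarrow> digraph_iso (with_proj T) (with_proj (SLP a (a + 1) 0 (k - 1) 0))"
    using iso_SLP_imp_inner_star inner_star_imp_iso_SLP assms by fastforce
  finally show ?thesis unfolding \<mu> using upper(1) by simp
qed

end
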